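(* Let $n\ge 1$ be an integer. For $i=1,\dots,n-1$ the Gauss--Legendre polynomial $F^n_i$ can be written as $$F^n_i(t)=\frac{1}{2}(t^2-1)\left(\sum_{k=1}^{n-1}\frac{2k+1}{2k}\,\bigl(P_k(\tau_i)-P_k(\tau_{i+1})\bigr)P^{(1)}_{k-1}(t)\right).$$ Moreover, $$F^n_0(t)=1-\frac{1}{2}(t+1)\left(1+(t-1)\sum_{k=1}^{n-1}\frac{2k+1}{2k}P_k(\tau_1)P^{(1)}_{k-1}(t)\right),$$ $$F^n_n(t)=\frac{1}{2}(t+1)\left(1+(t-1)\sum_{k=1}^{n-1}\frac{2k+1}{2k}P_k(\tau_n)P^{(1)}_{k-1}(t)\right).$$ (All identities are identities of polynomials in $t$.)
   Context: For $\alpha>-1$, $P^{(\alpha)}_k:=P^{(\alpha,\alpha)}_k$ denotes the symmetric Jacobi polynomial of degree $k$, i.e. the $P^{(\alpha)}_k$ $(k=0,1,\dots)$ are orthogonal on $[-1,1]$ with respect to the weight $(1-x^2)^\alpha$ and normalized by $P^{(\alpha)}_k(1)=\binom{k+\alpha}{k}$. Thus $P_k:=P^{(0)}_k$ is the Legendre polynomial ($P_k(1)=1$), and $P^{(1)}_k(1)=k+1$. For the fixed integer $n\ge1$, $-1<\tau_1<\tau_2<\cdots<\tau_n<1$ are the zeros of $P_n$. Empty sums are zero. Gauss--Legendre polynomials: set $G^n_0(t)\equiv\frac12$, $G^n_{n+1}(t)\equiv-\frac12$, and for $i=1,\dots,n$ $$G^n_i(t):=\frac{nP_{n-1}(\tau_i)}{2}\int_{-1}^{t}\frac{P_n(x)}{x-\tau_i}\,dx-\frac12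 ,$$ where $P_n(x)/(x-\tau_i)$ is regarded as a polynomial. Then $F^n_i(t):=G^n_i(t)-G^n_{i+1}(t)$ for $i=0,1,\dots,n$. *)

theory Defs
  imports "HOL-Analysis.Analysis" "HOL-Computational_Algebra.Polynomial"
begin

text \<open>
  The orthogonality clause uses has_integral rather than integral, so it also
  asserts integrability. Since 0 powr 0 = 0, the weight for \<alpha> = 0 is
  0 instead of 1 at the two endpoints; this null set does not affect the integral.
  The family exists and is unique for \<alpha> > -1.
\<close>

definition is_symmetric_jacobi :: "real \<Rightarrow> (nat \<Rightarrow> real poly) \<Rightarrow> bool" where
  "is_symmetric_jacobi \<alpha> P \<longleftrightarrow>
     (\<forall>k. degree (P k) = k) \<and>
     (\<forall>j k. j \<noteq> k \<longrightarrow>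
        ((\<lambda>x. poly (P j) x * poly (P k) x * (1 - x\<^sup>2) powr \<alpha>) has_integral 0) {-1..1}) \<and>
     (\<forall>k. poly (P k) 1 = (real k + \<alpha>) gchoose k)"

definition symmetric_jacobi :: "real \<Rightarrow> nat \<Rightarrow> real poly" where
  "symmetric_jacobi \<alpha> = (THE P. is_symmetric_jacobi \<alpha> P)"

abbreviation legendre :: "nat \<Rightarrow> real poly" where
  "legendre \<equiv> symmetric_jacobi 0"

text \<open>
  The i-th zero, in increasing order, of the n-th Legendre polynomial;
  meaningful for i in {1..n}.
\<close>

definition legendre_zero :: "nat \<Rightarrow> nat \<Rightarrow> real" where
  "legendre_zero n i = sorted_list_of_set {x. poly (legendre n) x = 0} ! (i - 1)"

text \<open>
  The quotient by x - legendre_zero n i is taken in the polynomial ring, where it is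
  exact. LBINT is the oriented integral, hence correct also for t < -1.
\<close>

definition gauss_legendre_G :: "nat \<Rightarrow> nat \<Rightarrow> real \<Rightarrow> real" where
  "gauss_legendre_G n i t =
     (if i = 0 then 1 / 2
      else if i = n + 1 then - 1 / 2
      else real n * poly (legendre (n - 1)) (legendre_zero n i) / 2 *
           (LBINT x=-1..t. poly (legendre n div [:- legendre_zero n i, 1:]) x) - 1 / 2)"

definition gauss_legendre_F :: "nat \<Rightarrow> nat \<Rightarrow> real \<Rightarrow> real" where
  "gauss_legendre_F n i t = gauss_legendre_G n i t - gauss_legendre_G n (i + 1) t"

end

theory Submission
  imports Defs "HOL-Computational_Algebra.Fundamental_Theorem_Algebra"
begin

text \<open>
  Everything rests on one expansion. If \<open>\<tau>\<close> is a zero of the Legendre polynomial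
  \<open>P\<^sub>n\<close>, then one of the two terms on the right of the Christoffel--Darboux formula vanishes and
  \[ n P_{n-1}(\tau) \frac{P_n(x)}{x - \tau} = \sum_{k=0}^{n-1} (2k+1) P_k(\tau) P_k(x). \]
  This expresses the integrand of \<open>G\<^sub>i\<close> through Legendre polynomials, whose primitives are known:
  Legendre's equation \<open>((x\<^sup>2 - 1) P\<^sub>k')' = k (k + 1) P\<^sub>k\<close> shows that, for \<open>k \<ge> 1\<close>, the primitive of
  \<open>P\<^sub>k\<close> vanishing at \<open>-1\<close> is \<open>(x\<^sup>2 - 1) P\<^sub>k' / (k (k + 1))\<close>. Finally \<open>P\<^sub>k'\<close> is \<open>(k + 1) / 2\<close> times the
  Jacobi polynomial of degree \<open>k - 1\<close> with parameter 1. The result is the closed form of \<open>G\<^sub>i\<close>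
  in \<open>gauss_legendre_G_closed_form\<close>; the three identities are differences of two such forms or of
  such a form and a constant.

  Three facts make this rigorous for families that are only characterised by degree,
  orthogonality and value at 1. First, the family is unique
  (\<open>is_symmetric_jacobi_unique\<close>): both candidates are orthogonal to all polynomials of
  lower degree, so a suitable combination of them is orthogonal to itself. Second, the polynomials defined by
  Bonnet's recurrence, and their rescaled derivatives, satisfy the characterisation. The recurrence
  yields Legendre's equation by pure algebra, and Legendre's equation yields both orthogonality relations
  through integration by parts, where the factor \<open>x\<^sup>2 - 1\<close> kills the boundary terms.
  Third, \<open>P\<^sub>n\<close> has \<open>n\<close> distinct real zeros (\<open>card_leg_roots\<close>), so that the \<open>i\<close>-th entry of the list
  of zeros is indeed a zero for every \<open>i\<close> from 1 to \<open>n\<close>.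
\<close>

section \<open>Integrals of polynomials over [-1, 1]\<close>

definition integral_poly :: "real poly \<Rightarrow> real" where
  "integral_poly p = integral {-1..1} (poly p)"

lemma integrable_poly: "poly p integrable_on {a..b::real}"
  by (intro integrable_continuous_real continuous_intros)

lemma integral_poly_add: "integral_poly (p + q) = integral_poly p + integral_poly q"
proof -
  have "poly (p + q) = (\<lambda>x. poly p x + poly q x)" by auto
  then show ?thesis
    unfolding integral_poly_def
    by (simp add: integrable_poly integral_add)
qed

lemma integral_poly_smult: "integral_poly (smult c p) = c * integral_poly p"
proof -
  have "poly (smult c p) = (\<lambda>x. c * poly p x)" by auto
  then show ?thesis unfolding integral_poly_def by simp
qed

lemma integral_poly_0 [simp]: "integral_poly 0 = 0"
  using integral_poly_smult[of 0 0] by simp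

lemma integral_poly_diff: "integral_poly (p - q) = integral_poly p - integral_poly q"
  using integral_poly_add[of "p - q" q] by simp

lemma integral_poly_pderiv: "integral_poly (pderiv p) = poly p 1 - poly p (-1)"
proof -
  have "(poly (pderiv p) has_integral poly p 1 - poly p (-1)) {-1..1}"
    by (rule fundamental_theorem_of_calculus)
       (auto intro!: derivative_eq_intros simp flip: has_real_derivative_iff_has_vector_derivative)
  then show ?thesis
    unfolding integral_poly_def by (rule integral_unique)
qed

lemma integral_poly_eq_0_imp_eq_0:
  assumes "integral_poly p = 0" and "\<And>x. \<lbrakk>-1 \<le> x; x \<le> 1\<rbrakk> \<Longrightarrow> poly p x \<ge> 0"
  shows "p = 0"
proof (rule ccontr)
  assume "p \<noteq> 0"
  have "\<forall>x\<in>{-1..1}. poly p x = 0"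
  proof (subst integral_eq_0_iff[symmetric])
    show "integral {-1..1} (poly p) = 0"
      using assms(1) by (simp add: integral_poly_def)
  qed (use assms(2) in \<open>auto intro!: continuous_intros\<close>)
  then have "{-1..1} \<subseteq> {x. poly p x = 0}" by auto
  then have "finite {-1..1::real}"
    using poly_roots_finite[OF \<open>p \<noteq> 0\<close>] finite_subset by blast
  then show False
    using infinite_Icc[of "-1::real" 1] by simp
qed

text \<open>
  The indeterminate is a constant of its own, not an abbreviation for \<open>[:0, 1:]\<close>, so that the
  simplifier treats products with it as products instead of turning them into coefficient lists.
\<close>

definition X :: "real poly" where "X = [:0, 1:]"

lemma poly_X [simp]: "poly X x = x"
  and degree_X [simp]: "degree X = 1"
  and pderiv_X [simp]: "pderiv X = 1"
  and X_nonzero [simp]: "X \<noteq> 0"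
  by (simp_all add: X_def pderiv_pCons)

section \<open>Uniqueness of the Jacobi family for integer parameters\<close>

text \<open>
  For a natural parameter the weight is a polynomial up to its values at the endpoints, so the
  characterisation involves integrals of polynomials only.
\<close>

lemma is_symmetric_jacobi_of_nat_iff:
  "is_symmetric_jacobi (real m) P \<longleftrightarrow>
     (\<forall>k. degree (P k) = k) \<and>
     (\<forall>j k. j \<noteq> k \<longrightarrow> integral_poly (P j * P k * (1 - X\<^sup>2) ^ m) = 0) \<and>
     (\<forall>k. poly (P k) 1 = real ((k + m) choose k))"
proof -
  have "((\<lambda>x. poly p x * (1 - x\<^sup>2) powr real m) has_integral 0) {-1..1} \<longleftrightarrow>
        integral_poly (p * (1 - X\<^sup>2) ^ m) = 0" for p
  proof -
    have w: "(1 - x\<^sup>2) powr real m = (1 - x\<^sup>2) ^ m" if "x \<in> {-1..1} - {-1, 1}" for x :: real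
    proof -
      have "\<bar>x\<bar> < 1" using that by auto
      then have "1 - x\<^sup>2 > 0" by (simp add: abs_square_less_1)
      then show ?thesis by (rule powr_realpow)
    qed
    have "((\<lambda>x. poly p x * (1 - x\<^sup>2) powr real m) has_integral 0) {-1..1} \<longleftrightarrow>
          (poly (p * (1 - X\<^sup>2) ^ m) has_integral 0) {-1..1}"
      by (rule has_integral_spike_finite_eq[where S = "{-1, 1}"]) (auto simp: w)
    also have "\<dots> \<longleftrightarrow> integral_poly (p * (1 - X\<^sup>2) ^ m) = 0"
      unfolding integral_poly_def using integrable_poly has_integral_iff by metis
    finally show ?thesis .
  qed
  from this[of "P _ * P _"] show ?thesis
    unfolding is_symmetric_jacobi_def
    by (simp add: binomial_gbinomial)
qed

lemma weight_nonneg: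
  "\<lbrakk>-1 \<le> x; x \<le> 1\<rbrakk> \<Longrightarrow> poly ((1 - X\<^sup>2) ^ m) x \<ge> 0"
  by (simp add: abs_square_le_1 abs_le_iff)

lemma weight_nonzero: "(1 - X\<^sup>2) ^ m \<noteq> 0"
proof -
  have "poly ((1 - X\<^sup>2) ^ m) 0 \<noteq> 0" by simp
  then show ?thesis by force
qed

text \<open>Used to lower degrees, both in the induction below and when comparing two families.\<close>

lemma eq_zero_or_degree_less_cancel_lead:
  fixes p q :: "'a::field poly"
  assumes "degree p = degree q" "q \<noteq> 0"
  defines "r \<equiv> p - smult (lead_coeff p / lead_coeff q) q"
  shows "r = 0 \<or> degree r < degree q"
proof -
  have "degree r \<le> degree q"
    unfolding r_def using assms by (metis degree_diff_le degree_smult_le order_refl)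
  moreover have "coeff r (degree q) = 0"
    using assms by (simp add: r_def)
  ultimately show ?thesis
    using eq_zero_or_degree_less by blast
qed

text \<open>
  The members of degree less than \<open>n\<close> span all polynomials of degree less than \<open>n\<close>;
  the induction replaces a span argument by cancelling one leading coefficient at a time.
\<close>

lemma orthogonal_lower_degree:
  assumes deg: "\<And>k. degree (P k) = k" and nonzero: "\<And>k. P k \<noteq> 0"
    and orth: "\<And>j k. j \<noteq> k \<Longrightarrow> integral_poly (P j * P k * w) = 0"
    and lower: "q = 0 \<or> degree q < n"
  shows "integral_poly (q * P n * w) = 0"
  using lower
proof (induction "degree q" arbitrary: q rule: less_induct)
  case less
  show ?case
  proof (cases "q = 0")
    case True
    then show ?thesis by simp
  next
    case False
    define r where "r = q - smult (lead_coeff q / lead_coeff (P (degree q))) (P (degree q))"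
    have r: "r = 0 \<or> degree r < degree q"
      using eq_zero_or_degree_less_cancel_lead[of q "P (degree q)"] nonzero deg by (simp add: r_def)
    have "integral_poly (r * P n * w) = 0"
      using r less by (cases "r = 0") auto
    moreover have "degree q \<noteq> n" using less.prems \<open>q \<noteq> 0\<close> by auto
    then have "integral_poly (P (degree q) * P n * w) = 0" by (rule orth)
    moreover have "q * P n * w = r * P n * w
        + smult (lead_coeff q / lead_coeff (P (degree q))) (P (degree q) * P n * w)"
      by (simp add: r_def algebra_simps)
    ultimately show ?thesis
      by (simp add: integral_poly_add integral_poly_smult)
  qed
qed

text \<open>
  The polynomial \<open>r\<close> with the leading terms of \<open>P\<^sub>n\<close> and \<open>Q\<^sub>n\<close> cancelled has degree less than \<open>n\<close>,
  hence is orthogonal to \<open>P\<^sub>n\<close> and \<open>Q\<^sub>n\<close> and therefore to itself, so it is 0. The common nonzero value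
  at 1 then fixes the scalar.
\<close>

lemma is_symmetric_jacobi_unique:
  assumes P: "is_symmetric_jacobi (real m) P" and Q: "is_symmetric_jacobi (real m) Q"
  shows "P = Q"
proof
  fix n
  note P = P[unfolded is_symmetric_jacobi_of_nat_iff] and Q = Q[unfolded is_symmetric_jacobi_of_nat_iff]
  define c where "c = lead_coeff (P n) / lead_coeff (Q n)"
  define r where "r = P n - smult c (Q n)"
  define w where "w = (1 - X\<^sup>2) ^ m"
  have nonzero: "P k \<noteq> 0" "Q k \<noteq> 0" for k
  proof -
    have "poly (P k) 1 \<noteq> 0" "poly (Q k) 1 \<noteq> 0" using P Q by auto
    then show "P k \<noteq> 0" "Q k \<noteq> 0" by auto
  qed
  have at_1: "poly (P n) 1 = poly (Q n) 1" "poly (Q n) 1 \<noteq> 0"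
    using P Q by auto
  have r: "r = 0 \<or> degree r < n"
    using eq_zero_or_degree_less_cancel_lead[of "P n" "Q n"] P Q nonzero by (simp add: r_def c_def)
  have "integral_poly (r * P n * w) = 0" "integral_poly (r * Q n * w) = 0"
    using P Q nonzero by (auto intro!: orthogonal_lower_degree[OF _ _ _ r] simp: w_def)
  moreover have "r * r * w = r * (P n - smult c (Q n)) * w"
    by (simp add: r_def)
  then have "r * r * w = r * P n * w - smult c (r * Q n * w)"
    by (simp add: left_diff_distrib right_diff_distrib)
  ultimately have "integral_poly (r * r * w) = 0"
    by (simp add: integral_poly_diff integral_poly_smult)
  then have "r * r * w = 0"
    by (rule integral_poly_eq_0_imp_eq_0)
       (use weight_nonneg[of _ m] in \<open>auto simp: w_def simp del: poly_power\<close>)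
  then have "r = 0" using weight_nonzero[of m] unfolding w_def mult_eq_0_iff by blast
  then have "P n = smult c (Q n)" by (simp add: r_def)
  moreover from this have "c = 1" using at_1 by simp
  ultimately show "P n = Q n" by simp
qed

lemma symmetric_jacobi_eqI:
  "is_symmetric_jacobi (real m) P \<Longrightarrow> symmetric_jacobi (real m) = P"
  unfolding symmetric_jacobi_def
  by (rule the_equality) (auto intro: is_symmetric_jacobi_unique)

section \<open>The Legendre polynomials from their recurrence\<close>

text \<open>
  Bonnet's recurrence. It serves as a concrete model of the Legendre family because the algebraic identities
  below, including Christoffel--Darboux, follow from it by induction.
\<close>

fun leg :: "nat \<Rightarrow> real poly" where
  "leg 0 = 1"
| "leg (Suc 0) = X"
| "leg (Suc (Suc k)) =
     smult (1 / real (k + 2)) (of_nat (2 * k + 3) * X * leg (Suc k) - of_nat (k + 1) * leg k)"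

text \<open>The factors are kept as naturals embedded in the polynomial ring, so that ring normalisation applies.\<close>

lemma leg_rec:
  "of_nat (k + 2) * leg (Suc (Suc k)) =
     of_nat (2 * k + 3) * X * leg (Suc k) - of_nat (k + 1) * leg k"
  by (simp add: of_nat_poly del: of_nat_add of_nat_mult of_nat_Suc)

lemma poly_leg_1: "poly (leg k) 1 = 1"
  by (induction k rule: leg.induct) (auto simp: field_simps)

lemma leg_nonzero: "leg k \<noteq> 0"
  using poly_leg_1[of k] by force

lemma degree_leg: "degree (leg k) = k"
proof (induction k rule: leg.induct)
  case (3 k)
  have "degree (of_nat (2 * k + 3) * X * leg (Suc k)) = Suc (Suc k)"
    using 3 leg_nonzero by (simp add: degree_mult_eq of_nat_poly del: of_nat_add of_nat_mult)
  moreover have "degree (of_nat (k + 1) * leg k) < Suc (Suc k)"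
    using 3 by (simp add: of_nat_poly del: of_nat_add of_nat_mult of_nat_Suc)
  ultimately have "degree (of_nat (2 * k + 3) * X * leg (Suc k) - of_nat (k + 1) * leg k) = Suc (Suc k)"
    using degree_add_eq_left[of "- (of_nat (k + 1) * leg k)" "of_nat (2 * k + 3) * X * leg (Suc k)"]
    by simp
  then show ?case
    by (simp del: of_nat_Suc of_nat_add of_nat_mult)
qed auto

(* The division-free form leg_rec replaces this equation, which would unfold every P of index k + 2. *)
declare leg.simps(3) [simp del]

lemma pderiv_nat [simp]: "pderiv (of_nat n) = 0" by (simp add: of_nat_poly)

text \<open>
  Differentiating the recurrence leaves a term \<open>P\<^sub>k'\<close>; the second relation removes it and so gives the
  first one for \<open>k + 1\<close>. The second one for \<open>k + 1\<close> then needs the first for \<open>k\<close>, whence the joint induction.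
\<close>

lemma pderiv_leg:
  shows "pderiv (leg (Suc k)) = X * pderiv (leg k) + of_nat (Suc k) * leg k" (is "?A k")
    and "X * pderiv (leg (Suc k)) = pderiv (leg k) + of_nat (Suc k) * leg (Suc k)" (is "?B k")
proof -
  have "?A k \<and> ?B k"
  proof (induction k)
    case 0
    show ?case by simp
  next
    case (Suc k)
    define P0 P1 P2 D0 D1 D2 N :: "real poly"
      where P0_def: "P0 = leg k" and P1_def: "P1 = leg (Suc k)" and P2_def: "P2 = leg (Suc (Suc k))" and
       D_def: "D0 = pderiv P0" "D1 = pderiv P1" "D2 = pderiv P2" and N_def: "N = of_nat k"
    note defs = P0_def P1_def P2_def N_def
    have rec: "(N + 2) * P2 = (2 * N + 3) * X * P1 - (N + 1) * P0"
      using leg_rec[of k] by (simp add: defs algebra_simps)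
    have "pderiv ((N + 2) * P2) = pderiv ((2 * N + 3) * X * P1 - (N + 1) * P0)"
      using rec by simp
    moreover have "pderiv N = 0" by (simp add: N_def)
    ultimately have rec': "(N + 2) * D2 = (2 * N + 3) * (P1 + X * D1) - (N + 1) * D0"
      unfolding D_def by (simp add: pderiv_mult pderiv_diff pderiv_add algebra_simps)
    have a: "D1 = X * D0 + (N + 1) * P0" and b: "X * D1 = D0 + (N + 1) * P1"
      using Suc[THEN conjunct1] Suc[THEN conjunct2]
      by (simp_all only: defs D_def of_nat_Suc add.commute)
    have "N + 2 = of_nat (k + 2)" by (simp add: N_def)
    then have "N + 2 \<noteq> 0" by (metis add_is_0 of_nat_eq_0_iff zero_neq_numeral)
    have D0: "D0 = X * D1 - (N + 1) * P1" using b by simp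
    have "(N + 2) * D2 = (N + 2) * (X * D1 + (N + 2) * P1)"
      unfolding rec' D0 by (simp add: algebra_simps)
    then have A: "D2 = X * D1 + (N + 2) * P1"
      using \<open>N + 2 \<noteq> 0\<close> by (metis mult_cancel_left)
    have "X * D2 = X * (D0 + (N + 1) * P1) + (N + 2) * X * P1"
      unfolding A b[symmetric] by (simp add: algebra_simps)
    also have "\<dots> = (X * D0 + (N + 1) * P0) + ((2 * N + 3) * X * P1 - (N + 1) * P0)"
      by (simp add: algebra_simps)
    finally have B: "X * D2 = D1 + (N + 2) * P2"
      unfolding a rec .
    show ?case using A B
      by (simp add: defs D_def algebra_simps)
  qed
  then show "?A k" "?B k" by auto
qed

text \<open>
  Legendre's equation. The two relations above give \<open>(x\<^sup>2 - 1) P\<^sub>k' = k (x P\<^sub>k - P\<^bsub>k-1\<^esub>)\<close>;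
  differentiate this and use the second relation once more.
\<close>

lemma leg_ode: "pderiv ((X\<^sup>2 - 1) * pderiv (leg k)) = of_nat (k * (k + 1)) * leg k"
proof (cases k)
  case 0 then show ?thesis by simp
next
  case (Suc j)
  note a = pderiv_leg(1)[of j] and b = pderiv_leg(2)[of j]
  have "(X\<^sup>2 - 1) * pderiv (leg (Suc j)) = of_nat (Suc j) * (X * leg (Suc j) - leg j)"
    using a b by algebra
  then have "pderiv ((X\<^sup>2 - 1) * pderiv (leg k)) = pderiv (of_nat (Suc j) * (X * leg (Suc j) - leg j))"
    using Suc by simp
  also have "\<dots> = of_nat (Suc j) * (leg (Suc j) + X * pderiv (leg (Suc j)) - pderiv (leg j))"
    by (simp add: pderiv_mult pderiv_diff del: of_nat_Suc)
  also have "\<dots> = of_nat (k * (k + 1)) * leg k"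
    unfolding b Suc by (simp add: algebra_simps)
  finally show ?thesis .
qed

section \<open>Orthogonality and the identification of both families\<close>

lemma pderiv_boundary:
  "integral_poly (pderiv ((X\<^sup>2 - 1) * p)) = 0"
  by (simp add: integral_poly_pderiv)

text \<open>
  Integration by parts for the operator of Legendre's equation. Its integrated form gives
  both orthogonality relations: for \<open>q = P\<^sub>j\<close> the right-hand side is symmetric in \<open>j\<close> and \<open>k\<close> while the
  eigenvalues differ, so the left integral vanishes; then so does the right one, which is the weighted
  integral of \<open>P\<^sub>j' P\<^sub>k'\<close>.
\<close>

lemma leg_green:
  "pderiv ((X\<^sup>2 - 1) * (pderiv (leg k) * q)) =
     smult (real (k * (k + 1))) (q * leg k) + (X\<^sup>2 - 1) * (pderiv (leg k) * pderiv q)"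
proof -
  have "pderiv ((X\<^sup>2 - 1) * (pderiv (leg k) * q)) = pderiv (((X\<^sup>2 - 1) * pderiv (leg k)) * q)"
    by (simp only: mult.assoc)
  also have "\<dots> = of_nat (k * (k + 1)) * leg k * q + ((X\<^sup>2 - 1) * pderiv (leg k)) * pderiv q"
    by (subst pderiv_mult, subst leg_ode) (simp add: algebra_simps)
  finally show ?thesis
    by (simp add: of_nat_poly algebra_simps del: of_nat_mult of_nat_add of_nat_Suc)
qed

lemma leg_green_integral:
  "real (k * (k + 1)) * integral_poly (q * leg k) =
     - integral_poly ((X\<^sup>2 - 1) * (pderiv (leg k) * pderiv q))"
  using pderiv_boundary[of "pderiv (leg k) * q"]
  unfolding leg_green integral_poly_add integral_poly_smult by simp

lemma leg_orthogonal:
  assumes "j \<noteq> k"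
  shows "integral_poly (leg j * leg k) = 0"
proof -
  have "real (k * (k + 1)) * integral_poly (leg j * leg k) =
        real (j * (j + 1)) * integral_poly (leg j * leg k)"
    using leg_green_integral[of k "leg j"] leg_green_integral[of j "leg k"]
    by (simp add: mult.commute)
  moreover have "k * (k + 1) \<noteq> j * (j + 1)"
  proof (cases "j < k")
    case True
    then have "j * (j + 1) < k * (k + 1)" by (intro mult_strict_mono) auto
    then show ?thesis by simp
  next
    case False
    then have "k * (k + 1) < j * (j + 1)" using assms by (intro mult_strict_mono) auto
    then show ?thesis by simp
  qed
  then have "real (k * (k + 1)) \<noteq> real (j * (j + 1))" by linarith
  ultimately show ?thesis by (metis mult_cancel_right)
qed

lemma pderiv_leg_orthogonal:
  assumes "j \<noteq> k"
  shows "integral_poly (pderiv (leg j) * pderiv (leg k) * (1 - X\<^sup>2)) = 0"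
proof -
  have "integral_poly ((X\<^sup>2 - 1) * (pderiv (leg k) * pderiv (leg j))) = 0"
    using leg_green_integral[of k "leg j"] leg_orthogonal[OF assms] by simp
  moreover have "pderiv (leg j) * pderiv (leg k) * (1 - X\<^sup>2) =
      smult (-1) ((X\<^sup>2 - 1) * (pderiv (leg k) * pderiv (leg j)))"
    by (simp add: algebra_simps)
  ultimately show ?thesis
    by (simp only: integral_poly_smult mult_zero_right)
qed

text \<open>Legendre's equation at \<open>x = 1\<close>, where the term with the second derivative drops out.\<close>

lemma poly_pderiv_leg_1: "poly (pderiv (leg k)) 1 = real (k * (k + 1)) / 2"
proof -
  have "poly (pderiv ((X\<^sup>2 - 1) * pderiv (leg k))) 1 = 2 * poly (pderiv (leg k)) 1"
    by (simp add: pderiv_mult pderiv_diff power2_eq_square)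
  then show ?thesis
    unfolding leg_ode by (simp add: poly_leg_1)
qed

lemma legendre_eq_leg: "legendre = leg"
proof -
  have "is_symmetric_jacobi (real 0) leg"
    unfolding is_symmetric_jacobi_of_nat_iff
    by (simp add: degree_leg leg_orthogonal poly_leg_1)
  from symmetric_jacobi_eqI[OF this] show ?thesis by simp
qed

lemma jacobi_1_eq: "symmetric_jacobi 1 = (\<lambda>k. smult (2 / real (k + 2)) (pderiv (leg (k + 1))))"
proof -
  have "is_symmetric_jacobi (real 1) (\<lambda>k. smult (2 / real (k + 2)) (pderiv (leg (k + 1))))"
    unfolding is_symmetric_jacobi_of_nat_iff
  proof (intro conjI allI impI)
    fix j k :: nat
    assume "j \<noteq> k"
    then show "integral_poly (smult (2 / real (j + 2)) (pderiv (leg (j + 1))) *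
            smult (2 / real (k + 2)) (pderiv (leg (k + 1))) * (1 - X\<^sup>2) ^ 1) = 0"
      using pderiv_leg_orthogonal[of "j + 1" "k + 1"]
      by (simp add: integral_poly_smult)
  next
    fix k
    show "degree (smult (2 / real (k + 2)) (pderiv (leg (k + 1)))) = k"
      by (simp add: degree_pderiv degree_leg)
  next
    fix k
    show "poly (smult (2 / real (k + 2)) (pderiv (leg (k + 1)))) 1 = real ((k + 1) choose k)"
      unfolding poly_smult poly_pderiv_leg_1 by (simp add: field_simps)
  qed
  from symmetric_jacobi_eqI[OF this] show ?thesis by simp
qed

section \<open>The Christoffel--Darboux formula\<close>

text \<open>
  Passing from \<open>n\<close> to \<open>n + 1\<close> amounts to eliminating \<open>P\<^bsub>n+2\<^esub>\<close> at \<open>x\<close> and at \<open>y\<close> by the recurrence.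
\<close>

lemma christoffel_darboux:
  "(\<Sum>k\<le>n. (2 * real k + 1) * poly (leg k) x * poly (leg k) y) * (x - y) =
     real (Suc n) * (poly (leg (Suc n)) x * poly (leg n) y - poly (leg n) x * poly (leg (Suc n)) y)"
proof (induction n)
  case 0
  show ?case by simp
next
  case (Suc n)
  have rec: "real (Suc (Suc n)) * poly (leg (Suc (Suc n))) z =
      (2 * real (Suc n) + 1) * z * poly (leg (Suc n)) z - real (Suc n) * poly (leg n) z" for z
    using arg_cong[OF leg_rec[of n], of "\<lambda>p. poly p z"] by (simp add: algebra_simps)
  show ?case
    using Suc rec[of x] rec[of y]
    unfolding sum.atMost_Suc distrib_right by algebra
qed

section \<open>The zeros of the Legendre polynomials\<close>

text \<open>
  A pair of conjugate complex zeros, or a multiple real zero, gives a quadratic factor that is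
  nonnegative on the real line. Without such a factor all zeros are real and simple.
\<close>

lemma card_roots_eq_degree:
  fixes p :: "real poly"
  assumes "p \<noteq> 0"
    and "\<And>q r. p = q * r \<Longrightarrow> degree r = 2 \<Longrightarrow> \<exists>x. poly r x < 0"
  shows "card {x. poly p x = 0} = degree p"
  using assms
proof (induction "degree p" arbitrary: p rule: less_induct)
  case (less p)
  consider a where "poly p a = 0" | "degree p = 0" | "\<And>a. poly p a \<noteq> 0" "degree p \<noteq> 0" by blast
  then show ?case
  proof cases
    case (1 a)
    then obtain q where q: "p = [:-a, 1:] * q" by (auto simp: poly_eq_0_iff_dvd)
    then have "q \<noteq> 0" using less.prems by auto
    then have deg: "degree p = Suc (degree q)"
      unfolding q by (subst degree_mult_eq) auto
    have "poly q a \<noteq> 0"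
    proof
      assume "poly q a = 0"
      then obtain s where "q = [:-a, 1:] * s" by (auto simp: poly_eq_0_iff_dvd)
      then have "p = s * [:-a, 1:]\<^sup>2" 
        unfolding q power2_eq_square by (simp only: mult_ac)
      moreover have "degree ([:-a, 1:]\<^sup>2) = 2" by (simp add: degree_power_eq)
      ultimately obtain x where "poly ([:-a, 1:]\<^sup>2) x < 0" using less.prems(2) by blast
      then show False by (simp add: not_less[symmetric])
    qed
    moreover have "{x. poly p x = 0} = insert a {x. poly q x = 0}" by (auto simp: q)
    moreover have "card {x. poly q x = 0} = degree q"
    proof (rule less.hyps)
      fix s r assume "q = s * r" "degree r = 2"
      then show "\<exists>x. poly r x < 0"
        using less.prems(2)[of "[:-a, 1:] * s" r] unfolding q mult.assoc by blast
    qed (use deg \<open>q \<noteq> 0\<close> in auto)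
    ultimately show ?thesis
      using deg poly_roots_finite[OF \<open>q \<noteq> 0\<close>] by simp
  next
    case 2
    then obtain c where "p = [:c:]" by (metis degree_eq_zeroE)
    then show ?thesis using less.prems(1) by simp
  next
    case 3
    define P where "P = map_poly complex_of_real p"
    have "degree P \<noteq> 0" using 3 by (simp add: P_def degree_map_poly)
    then have "\<not> constant (poly P)" by (simp add: constant_degree)
    then obtain z where z: "poly P z = 0" using fundamental_theorem_of_algebra by blast
    have real_at: "poly (map_poly complex_of_real q) (of_real x) = of_real (poly q x)" for q x
      by (induction q) (auto simp: map_poly_pCons)
    have Im: "Im z \<noteq> 0"
    proof
      assume "Im z = 0"
      then have "z = of_real (Re z)" by (simp add: complex_eq_iff)
      then show False using z 3(1)[of "Re z"] real_at[of p "Re z"] by (simp add: P_def)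
    qed
    \<comment> \<open>the product of \<open>x - z\<close> and \<open>x - cnj z\<close>; it divides \<open>p\<close> because the remainder is linear with
      real coefficients and vanishes at the non-real \<open>z\<close>\<close>
    define r where "r = [:(Re z)\<^sup>2 + (Im z)\<^sup>2, - 2 * Re z, 1:]"
    have deg_r: "degree r = 2" by (simp add: r_def)
    have z_r: "poly (map_poly complex_of_real r) z = 0"
      by (simp add: r_def map_poly_pCons complex_eq_iff power2_eq_square algebra_simps)
    have "degree (p mod r) < 2" using degree_mod_less[of r p] deg_r by fastforce
    then have "p mod r = [:coeff (p mod r) 0, coeff (p mod r) 1:]"
      by (intro poly_eqI) (auto simp: coeff_pCons coeff_eq_0 split: nat.splits)
    then obtain b c where bc: "p mod r = [:b, c:]" by blast
    have eq: "p = (p div r) * r + [:b, c:]" using bc div_mult_mod_eq[of p r] by simp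
    have hom: "map_poly complex_of_real (f * g + h) =
        map_poly complex_of_real f * map_poly complex_of_real g + map_poly complex_of_real h" for f g h
      by (rule poly_eqI) (simp add: coeff_map_poly coeff_mult)
    have "poly (map_poly complex_of_real [:b, c:]) z = 0"
      using z z_r hom[of "p div r" r "[:b, c:]"] eq by (simp add: P_def)
    then have "of_real b + z * of_real c = 0" by (simp add: map_poly_pCons)
    then have "c = 0" "b = 0" using Im by (auto simp: complex_eq_iff)
    then have "p = (p div r) * r" using eq by simp
    with deg_r obtain x where "poly r x < 0" using less.prems(2) by blast
    moreover have "poly r x = (x - Re z)\<^sup>2 + (Im z)\<^sup>2"
      by (simp add: r_def power2_eq_square algebra_simps)
    ultimately show ?thesis by (smt (verit) zero_le_power2)
  qed
qed

text \<open>
  If \<open>P\<^sub>n = q r\<close> with \<open>r\<close> quadratic and nonnegative, then \<open>P\<^sub>n q = q\<^sup>2 r\<close> is nonnegative and nonzero,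
  yet it has integral 0 since \<open>q\<close> has degree \<open>n - 2\<close>.
\<close>

lemma card_leg_roots: "card {x. poly (leg n) x = 0} = n"
proof -
  have "card {x. poly (leg n) x = 0} = degree (leg n)"
  proof (rule card_roots_eq_degree[OF leg_nonzero])
    fix q r assume qr: "leg n = q * r" "degree r = 2"
    then have "q \<noteq> 0" "r \<noteq> 0" using leg_nonzero by (metis mult_zero_left mult_zero_right)+
    then have "n = degree q + 2" using qr degree_leg[of n] by (simp add: degree_mult_eq)
    then have "degree q < n" by simp
    then have "integral_poly (q * leg n * 1) = 0"
      using orthogonal_lower_degree[where P = leg and w = 1, OF degree_leg leg_nonzero _ disjI2]
      by (metis leg_orthogonal mult_1_right)
    then have "integral_poly (q * q * r) = 0" unfolding qr(1) by (simp add: mult.assoc)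
    moreover have "q * q * r \<noteq> 0" using \<open>q \<noteq> 0\<close> \<open>r \<noteq> 0\<close> by simp
    ultimately obtain x where "poly (q * q * r) x < 0"
      using integral_poly_eq_0_imp_eq_0[of "q * q * r"] not_le by blast
    then show "\<exists>x. poly r x < 0"
      by (auto simp: mult_less_0_iff)
  qed
  then show ?thesis by (simp add: degree_leg)
qed

lemma legendre_zero_root:
  assumes "i \<in> {1..n}"
  shows "poly (leg n) (legendre_zero n i) = 0"
proof -
  let ?S = "{x. poly (leg n) x = 0}"
  have "finite ?S" using poly_roots_finite[OF leg_nonzero] .
  then have set: "set (sorted_list_of_set ?S) = ?S" and len: "length (sorted_list_of_set ?S) = n"
    by (simp_all add: card_leg_roots)
  have "i - 1 < length (sorted_list_of_set ?S)"
    unfolding len using assms by auto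
  from nth_mem[OF this] have "sorted_list_of_set ?S ! (i - 1) \<in> ?S"
    unfolding set .
  then show ?thesis by (simp add: legendre_zero_def legendre_eq_leg)
qed

section \<open>The closed form of the Gauss--Legendre polynomials\<close>

lemma interval_integral_pderiv:
  "(LBINT x=a..b. poly (pderiv p) x) = poly p b - poly p a" for a b :: real
  by (rule interval_integral_FTC_finite)
     (auto intro!: continuous_intros derivative_eq_intros
        simp flip: has_real_derivative_iff_has_vector_derivative)

text \<open>
  The Christoffel--Darboux expansion integrated term by term. The summand \<open>k = 0\<close> has the
  primitive \<open>x + 1\<close> and is split off, since Legendre's equation gives no primitive for eigenvalue 0.
\<close>

lemma gauss_legendre_G_closed_form:
  assumes i: "i \<in> {1..n}"
  shows "gauss_legendre_G n i t = (t + 1) / 2 + (t\<^sup>2 - 1) / 2 *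
     (\<Sum>k = 1..n - 1. (2 * real k + 1) / (2 * real k) * poly (legendre k) (legendre_zero n i) *
                 poly (symmetric_jacobi 1 (k - 1)) t) - 1 / 2"
proof -
  define \<tau> where "\<tau> = legendre_zero n i"
  obtain m where m: "n = Suc m" using i by (cases n) auto
  define a where "a k = (2 * real k + 1) * poly (leg k) \<tau>" for k
  define c where "c = real n * poly (leg (n - 1)) \<tau>"
  define q where "q = leg n div [:-\<tau>, 1:]"
  have root: "poly (leg n) \<tau> = 0" unfolding \<tau>_def using i by (rule legendre_zero_root)
  have q: "leg n = [:-\<tau>, 1:] * q"
    using root unfolding q_def poly_eq_0_iff_dvd by (simp only: dvd_mult_div_cancel)
  have "smult c q * [:-\<tau>, 1:] = (\<Sum>k\<le>m. smult (a k) (leg k)) * [:-\<tau>, 1:]"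
  proof (intro poly_eq_poly_eq_iff[THEN iffD1] ext)
    fix x
    have "poly (smult c q * [:-\<tau>, 1:]) x = c * poly (leg n) x"
      unfolding q by (simp add: algebra_simps)
    also have "\<dots> = (\<Sum>k\<le>m. a k * poly (leg k) x) * (x - \<tau>)"
      using christoffel_darboux[where n = m and x = x and y = \<tau>] root
      by (simp add: c_def a_def m mult_ac del: of_nat_Suc)
    finally show "poly (smult c q * [:-\<tau>, 1:]) x =
        poly ((\<Sum>k\<le>m. smult (a k) (leg k)) * [:-\<tau>, 1:]) x"
      by (simp add: poly_sum algebra_simps)
  qed
  then have cq: "smult c q = (\<Sum>k\<le>m. smult (a k) (leg k))"
    by (subst (asm) mult_cancel_right) simp
  \<comment> \<open>\<open>R k\<close> is the primitive of the \<open>k\<close>-th summand that Legendre's equation supplies; it vanishes at \<open>-1\<close>\<close>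
  define R where "R = (\<lambda>k. smult (a k / real (k * (k + 1))) ((X\<^sup>2 - 1) * pderiv (leg k)))"
  define Q where "Q = X + (\<Sum>k=1..m. R k)"
  have dR: "pderiv (R k) = smult (a k) (leg k)" if "k \<in> {1..m}" for k
    using that unfolding R_def pderiv_smult leg_ode
    by (simp add: of_nat_poly del: of_nat_mult of_nat_add of_nat_Suc)
  have "pderiv Q = smult (a 0) (leg 0) + (\<Sum>k=1..m. smult (a k) (leg k))"
    using dR by (simp add: Q_def pderiv_add higher_pderiv_sum[of 1, simplified] a_def)
  also have "\<dots> = smult c q"
    unfolding cq atMost_atLeast0 by (simp add: sum.atLeast_Suc_atMost)
  finally have dQ: "pderiv Q = smult c q" .
  have "c * (LBINT x=-1..t. poly q x) = (LBINT x=-1..t. poly (pderiv Q) x)"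
    unfolding dQ by simp
  also have "\<dots> = poly Q t - poly Q (-1)"
    using interval_integral_pderiv[of "-1" t Q] by (simp add: one_ereal_def)
  also have "\<dots> = t + 1 + (\<Sum>k=1..m. poly (R k) t)"
    by (simp add: Q_def poly_sum R_def)
  also have "(\<Sum>k=1..m. poly (R k) t) = (t\<^sup>2 - 1) *
      (\<Sum>k=1..m. (2 * real k + 1) / (2 * real k) * poly (leg k) \<tau> * poly (symmetric_jacobi 1 (k - 1)) t)"
    unfolding sum_distrib_left
  proof (rule sum.cong)
    fix k assume "k \<in> {1..m}"
    then have J: "symmetric_jacobi 1 (k - 1) = smult (2 / (real k + 1)) (pderiv (leg k))"
      by (simp add: jacobi_1_eq of_nat_diff add.commute)
    have "real k \<noteq> 0" "real k + 1 \<noteq> 0" using \<open>k \<in> {1..m}\<close> by auto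
    then show "poly (R k) t = (t\<^sup>2 - 1) *
        ((2 * real k + 1) / (2 * real k) * poly (leg k) \<tau> * poly (symmetric_jacobi 1 (k - 1)) t)"
      unfolding R_def a_def J of_nat_mult of_nat_add of_nat_1 poly_smult poly_mult
      by (simp add: divide_simps)
  qed simp
  finally have "c * (LBINT x=-1..t. poly q x) = t + 1 + (t\<^sup>2 - 1) *
      (\<Sum>k=1..n - 1. (2 * real k + 1) / (2 * real k) * poly (leg k) \<tau> * poly (symmetric_jacobi 1 (k - 1)) t)"
    by (simp add: m)
  moreover have "gauss_legendre_G n i t = c * (LBINT x=-1..t. poly q x) / 2 - 1 / 2"
    using i by (simp add: gauss_legendre_G_def legendre_eq_leg c_def q_def \<tau>_def)
  ultimately show ?thesis
    by (simp add: legendre_eq_leg \<tau>_def add_divide_distrib)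
qed

theorem theorem4p7:
  fixes n :: nat
  assumes "n \<ge> 1"
  shows "(\<forall>i\<in>{1..n - 1}. \<forall>t::real.
            gauss_legendre_F n i t =
              1 / 2 * (t\<^sup>2 - 1) *
              (\<Sum>k = 1..n - 1. (2 * real k + 1) / (2 * real k) *
                 (poly (legendre k) (legendre_zero n i)
                    - poly (legendre k) (legendre_zero n (i + 1))) *
                 poly (symmetric_jacobi 1 (k - 1)) t))
       \<and> (\<forall>t::real.
            gauss_legendre_F n 0 t =
              1 - 1 / 2 * (t + 1) *
              (1 + (t - 1) *
                (\<Sum>k = 1..n - 1. (2 * real k + 1) / (2 * real k) *
                   poly (legendre k) (legendre_zero n 1) *
                   poly (symmetric_jacobi 1 (k - 1)) t)))
       \<and> (\<forall>t::real.
            gauss_legendre_F n n t =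
              1 / 2 * (t + 1) *
              (1 + (t - 1) *
                (\<Sum>k = 1..n - 1. (2 * real k + 1) / (2 * real k) *
                   poly (legendre k) (legendre_zero n n) *
                   poly (symmetric_jacobi 1 (k - 1)) t)))"
proof -
  let ?S = "\<lambda>i t. \<Sum>k = 1..n - 1. (2 * real k + 1) / (2 * real k) *
      poly (legendre k) (legendre_zero n i) * poly (symmetric_jacobi 1 (k - 1)) t"
  have diff: "((t + 1) / 2 + (t\<^sup>2 - 1) / 2 * A - 1 / 2) - ((t + 1) / 2 + (t\<^sup>2 - 1) / 2 * B - 1 / 2)
      = 1 / 2 * (t\<^sup>2 - 1) * (A - B)" for t A B :: real
    by (simp add: field_simps)
  have first: "1 / 2 - ((t + 1) / 2 + (t\<^sup>2 - 1) / 2 * A - 1 / 2)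
      = 1 - 1 / 2 * (t + 1) * (1 + (t - 1) * A)" for t A :: real
    by (simp add: field_simps power2_eq_square)
  have last: "((t + 1) / 2 + (t\<^sup>2 - 1) / 2 * A - 1 / 2) - - 1 / 2
      = 1 / 2 * (t + 1) * (1 + (t - 1) * A)" for t A :: real
    by (simp add: field_simps power2_eq_square)
  note G = gauss_legendre_G_closed_form
  have G0: "gauss_legendre_G n 0 t = 1 / 2" "gauss_legendre_G n (n + 1) t = - 1 / 2" for t
    by (simp_all add: gauss_legendre_G_def)
  have split: "(\<Sum>k = 1..n - 1. (2 * real k + 1) / (2 * real k) *
      (poly (legendre k) (legendre_zero n i) - poly (legendre k) (legendre_zero n (i + 1))) *
      poly (symmetric_jacobi 1 (k - 1)) t) = ?S i t - ?S (i + 1) t" for i t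
    unfolding sum_subtractf[symmetric] by (simp add: left_diff_distrib right_diff_distrib)
  show ?thesis
  proof (intro conjI ballI allI)
    fix i t assume "i \<in> {1..n - 1}"
    then have "i \<in> {1..n}" "i + 1 \<in> {1..n}" by auto
    then show "gauss_legendre_F n i t = 1 / 2 * (t\<^sup>2 - 1) *
        (\<Sum>k = 1..n - 1. (2 * real k + 1) / (2 * real k) *
          (poly (legendre k) (legendre_zero n i) - poly (legendre k) (legendre_zero n (i + 1))) *
          poly (symmetric_jacobi 1 (k - 1)) t)"
      unfolding split gauss_legendre_F_def by (simp only: G diff)
  next
    fix t
    have "1 \<in> {1..n}" using assms by simp
    then show "gauss_legendre_F n 0 t = 1 - 1 / 2 * (t + 1) * (1 + (t - 1) * ?S 1 t)"
      unfolding gauss_legendre_F_def add_0 G0 by (simp only: G first)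
  next
    fix t
    have "n \<in> {1..n}" using assms by simp
    then show "gauss_legendre_F n n t = 1 / 2 * (t + 1) * (1 + (t - 1) * ?S n t)"
      unfolding gauss_legendre_F_def G0 by (simp only: G last)
  qed
qed

end
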